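(* Let $d\geq 1$ and let $k$ be a positive integer. Then $$\left(k-1+\frac{1}{k}\right)^d\ \geq\ \inf_{\{0,1,\dots,k-1\}^d\subseteq A\subset\mathbb{Z}^d,\ A \text{ finite}}\frac{|kA|}{|A|}\ \geq\ k^{\frac{d(k-1)}{k}}.$$
   Context: For a set $A\subseteq\mathbb{Z}^d$, $kA=A+A+\dots+A$ ($k$ summands, Minkowski sum), and $|\cdot|$ denotes cardinality. *)

theory Defs
  imports "HOL-Analysis.Finite_Cartesian_Product" "HOL-Library.Set_Algebras"
begin

text \<open>The lattice of dimension \<open>d\<close> is the type \<^typ>\<open>int ^ 'n\<close> with \<open>d = CARD('n)\<close>; types are
  nonempty, so \<open>d \<ge> 1\<close> holds automatically.\<close>

text \<open>The sum below is taken in the additive monoid of sets, i.e. with respect to the Minkowski sum.\<close>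

definition iterated_sumset :: "nat \<Rightarrow> 'a::comm_monoid_add set \<Rightarrow> 'a set" where
  "iterated_sumset k A = (\<Sum>i<k. A)"

definition discrete_cube :: "nat \<Rightarrow> (int ^ 'n) set" where
  "discrete_cube k = {x. \<forall>i. x $ i \<in> {0..int k - 1}}"

end

theory Submission imports Defs begin

text \<open>The upper bound is attained at the cube itself. For the lower bound, every nonempty
  \<open>X \<subseteq> A\<close> satisfies \<open>X + kA \<supseteq> kX + {0..k-1}\<^sup>d\<close>, which contains the disjoint boxes
  \<open>k x + {0..k-1}\<^sup>d\<close> for \<open>x \<in> X\<close>, so \<open>|X + kA| \<ge> k\<^sup>d |X|\<close>. Pluennecke's inequality, applied to the
  layers \<open>A + jA\<close> with \<open>j = k - 1\<close> and \<open>j = k\<close>, turns this into the bound on \<open>|A + (k-1)A|\<close>. It is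
  proved following Petridis: in the layered addition graph with weight \<open>C\<^sup>-\<^sup>i\<close> on layer \<open>i\<close>, a cut of
  minimum weight can be pushed into the first and last layers, where its weight is at least
  \<open>|A|\<close>; layer \<open>j\<close> is itself a cut.\<close>

section \<open>Iterated sumsets\<close>

lemma iterated_sumset_0 [simp]: "iterated_sumset 0 A = {0}"
  by (simp add: iterated_sumset_def)

lemma iterated_sumset_Suc: "iterated_sumset (Suc n) A = iterated_sumset n A + A"
  by (simp add: iterated_sumset_def add.commute)

lemma iterated_sumset_mono: "A \<subseteq> B \<Longrightarrow> iterated_sumset n A \<subseteq> iterated_sumset n B"
  by (induction n) (simp_all add: iterated_sumset_Suc set_plus_mono2)

lemma finite_iterated_sumset: "finite A \<Longrightarrow> finite (iterated_sumset n A)"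
  by (induction n) (auto simp: iterated_sumset_Suc intro: finite_set_plus)

section \<open>Double counting of degrees between consecutive layers\<close>

text \<open>Layer-cake formula: the pairs \<open>(x, a)\<close> with
  \<open>1 \<le> a \<le> f x\<close> are counted by \<open>x\<close> and by \<open>a\<close>. The
  bound \<open>m\<close> gives all functions in the application the same range of levels.\<close>

lemma sum_eq_sum_card_superlevel:
  fixes f :: "'a \<Rightarrow> nat"
  assumes "finite X" and "\<And>x. x \<in> X \<Longrightarrow> f x \<le> m"
  shows "(\<Sum>x\<in>X. f x) = (\<Sum>a\<in>{1..m}. card {x\<in>X. a \<le> f x})"
proof -
  have "(\<Sum>x\<in>X. f x) = (\<Sum>x\<in>X. card {a\<in>{1..m}. a \<le> f x})"
  proof (rule sum.cong)
    fix x assume "x \<in> X"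
    then have "{a\<in>{1..m}. a \<le> f x} = {1..f x}"
      using assms(2)[of x] by auto
    then show "f x = card {a\<in>{1..m}. a \<le> f x}" by simp
  qed simp
  also have "\<dots> = (\<Sum>a\<in>{1..m}. card {x\<in>X. a \<le> f x})"
    using sum.swap_restrict[of X "{1..m}" "\<lambda>_ _. 1::nat" "\<lambda>x a. a \<le> f x"] assms(1) by simp
  finally show ?thesis .
qed

text \<open>The edges from \<open>P\<close> to \<open>S\<close> with label in \<open>B\<close> are
  counted at their lower and at their upper ends.\<close>

lemma sum_card_translates_swap:
  fixes P S B :: "'a::ab_group_add set"
  assumes "finite P" "finite S" "finite B"
  shows "(\<Sum>u\<in>P. card {b\<in>B. u + b \<in> S}) = (\<Sum>v\<in>S. card {b\<in>B. v - b \<in> P})"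
proof -
  have "(\<Sum>u\<in>P. card {b\<in>B. u + b \<in> S}) = card (SIGMA u:P. {b\<in>B. u + b \<in> S})"
    using assms by simp
  also have "\<dots> = card (SIGMA v:S. {b\<in>B. v - b \<in> P})"
    by (rule bij_betw_same_card[of "\<lambda>(u, b). (u + b, b)"],
        rule bij_betw_byWitness[where f' = "\<lambda>(v, b). (v - b, b)"]) auto
  finally show ?thesis using assms by simp
qed

text \<open>Both expansion hypotheses are summed over superlevel sets of degrees. Commutativity of the
  group makes degrees monotone along edges, so the two sums bound the same edge counts in opposite
  directions and all inequalities are equalities.\<close>

lemma balanced_layer_card:
  fixes P S N B :: "'a::ab_group_add set" and C :: real
  assumes fin: "finite P" "finite S" "finite N" "finite B" and C: "C > 0"
    and square: "\<And>u b c. \<lbrakk>u \<in> P; b \<in> B; c \<in> B; u + b \<in> S; u + b + c \<in> N\<rbrakk> \<Longrightarrow> u + c \<in> S"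
    and down: "\<And>T. T \<subseteq> S \<Longrightarrow> card T \<le> C * card {u\<in>P. \<exists>b\<in>B. u + b \<in> T}"
    and up: "\<And>T. T \<subseteq> S \<Longrightarrow> C * card T \<le> card {w\<in>N. \<exists>b\<in>B. w - b \<in> T}"
  shows "C * card {u\<in>P. \<exists>b\<in>B. u + b \<in> S} = card S"
proof -
  define out where "out X u = card {b\<in>B. u + b \<in> X}" for X u
  define inn where "inn X u = card {b\<in>B. u - b \<in> X}" for X u
  have le: "out X u \<le> card B" "inn X u \<le> card B" for X u
    unfolding out_def inn_def using fin by (auto intro: card_mono)
  have out_pos: "1 \<le> out X u \<longleftrightarrow> (\<exists>b\<in>B. u + b \<in> X)" for X u
  proof -
    have "out X u = 0 \<longleftrightarrow> {b\<in>B. u + b \<in> X} = {}"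
      unfolding out_def using fin by simp
    then show ?thesis by (auto simp: Suc_le_eq)
  qed
  have down': "real (card {v\<in>S. a \<le> out N v}) \<le> C * card {u\<in>P. a \<le> out S u}" for a
  proof -
    have "{u\<in>P. \<exists>b\<in>B. u + b \<in> {v\<in>S. a \<le> out N v}} \<subseteq> {u\<in>P. a \<le> out S u}"
    proof safe
      fix u b assume "u \<in> P" "b \<in> B" "u + b \<in> S" "a \<le> out N (u + b)"
      \<comment> \<open>By \<open>square\<close>, every label leading from \<open>u + b\<close> into
        \<open>N\<close> also leads from \<open>u\<close> into \<open>S\<close>.\<close>
      moreover from this have "out N (u + b) \<le> out S u"
        unfolding out_def using fin square by (intro card_mono) auto
      ultimately show "a \<le> out S u" by simp
    qed
    then have "card {u\<in>P. \<exists>b\<in>B. u + b \<in> {v\<in>S. a \<le> out N v}} \<le> card {u\<in>P. a \<le> out S u}"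
      using fin by (intro card_mono) auto
    then have "C * card {u\<in>P. \<exists>b\<in>B. u + b \<in> {v\<in>S. a \<le> out N v}} \<le> C * card {u\<in>P. a \<le> out S u}"
      using C by (intro mult_left_mono) auto
    then show ?thesis
      by (rule order_trans[OF down, rotated]) auto
  qed
  have up': "C * card {v\<in>S. a \<le> inn P v} \<le> card {w\<in>N. a \<le> inn S w}" for a
  proof -
    have "{w\<in>N. \<exists>b\<in>B. w - b \<in> {v\<in>S. a \<le> inn P v}} \<subseteq> {w\<in>N. a \<le> inn S w}"
    proof safe
      fix w b assume w: "w \<in> N" "b \<in> B" "w - b \<in> S" "a \<le> inn P (w - b)"
      have "inn P (w - b) \<le> inn S w"
        unfolding inn_def
      proof (intro card_mono subsetI)
        fix c assume c: "c \<in> {c\<in>B. w - b - c \<in> P}"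
        \<comment> \<open>The labels \<open>c\<close> and \<open>b\<close> on the path from
          \<open>w - b - c\<close> to \<open>w\<close> are swapped, so the path runs through
          \<open>w - c\<close>.\<close>
        have "w - b - c + b \<in> S"
          by (rule square[of _ c]) (use w c in simp_all)
        moreover have "w - b - c + b = w - c" by (simp add: algebra_simps)
        ultimately have "w - c \<in> S" by (simp only:)
        with c show "c \<in> {c\<in>B. w - c \<in> S}" by simp
      qed (use fin in auto)
      with w show "a \<le> inn S w" by simp
    qed
    then have "card {w\<in>N. \<exists>b\<in>B. w - b \<in> {v\<in>S. a \<le> inn P v}} \<le> card {w\<in>N. a \<le> inn S w}"
      using fin by (intro card_mono) auto
    then have "real (card {w\<in>N. \<exists>b\<in>B. w - b \<in> {v\<in>S. a \<le> inn P v}}) \<le> card {w\<in>N. a \<le> inn S w}"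
      by (simp only: of_nat_le_iff)
    then show ?thesis
      by (rule order_trans[OF up, rotated]) auto
  qed
  \<comment> \<open>The chain says that \<open>C\<close> times the number of edges from
    \<open>P\<close> to \<open>S\<close> is at most the number of edges from \<open>S\<close> to
    \<open>N\<close>. Summing \<open>down'\<close> over the levels gives the reverse, so equality
    holds level by level.\<close>
  have "C * (\<Sum>a\<in>{1..card B}. real (card {u\<in>P. a \<le> out S u})) = C * real (\<Sum>u\<in>P. out S u)"
    using sum_eq_sum_card_superlevel[of P "out S" "card B"] fin le by simp
  also have "\<dots> = C * real (\<Sum>v\<in>S. inn P v)"
    using sum_card_translates_swap[of P S B] fin by (simp add: out_def inn_def)
  also have "\<dots> = (\<Sum>a\<in>{1..card B}. C * card {v\<in>S. a \<le> inn P v})"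
    using sum_eq_sum_card_superlevel[of S "inn P" "card B"] fin le by (simp add: sum_distrib_left)
  also have "\<dots> \<le> (\<Sum>a\<in>{1..card B}. real (card {w\<in>N. a \<le> inn S w}))"
    by (intro sum_mono up')
  also have "\<dots> = real (\<Sum>w\<in>N. inn S w)"
    using sum_eq_sum_card_superlevel[of N "inn S" "card B"] fin le by simp
  also have "\<dots> = real (\<Sum>v\<in>S. out N v)"
    using sum_card_translates_swap[of S N B] fin by (simp add: out_def inn_def)
  also have "\<dots> = (\<Sum>a\<in>{1..card B}. real (card {v\<in>S. a \<le> out N v}))"
    using sum_eq_sum_card_superlevel[of S "out N" "card B"] fin le by simp
  finally have "(\<Sum>a\<in>{1..card B}. C * card {u\<in>P. a \<le> out S u} - card {v\<in>S. a \<le> out N v}) \<le> 0"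
    by (simp add: sum_subtractf sum_distrib_left)
  moreover have "(\<Sum>a\<in>{1..card B}. C * card {u\<in>P. a \<le> out S u} - card {v\<in>S. a \<le> out N v}) \<ge> 0"
    by (intro sum_nonneg) (use down' in simp)
  ultimately have "(\<Sum>a\<in>{1..card B}. C * card {u\<in>P. a \<le> out S u} - card {v\<in>S. a \<le> out N v}) = 0"
    by (rule antisym)
  then have "\<forall>a\<in>{1..card B}. C * card {u\<in>P. a \<le> out S u} - card {v\<in>S. a \<le> out N v} = 0"
    by (subst (asm) sum_nonneg_eq_0_iff) (use down' in simp_all)
  then have eq: "C * card {u\<in>P. a \<le> out S u} = card {v\<in>S. a \<le> out N v}" if "a \<in> {1..card B}" for a
    using that by simp
  show ?thesis
  proof (cases "S = {}")
    case False
    \<comment> \<open>Only level 1 of \<open>eq\<close> is wanted. By \<open>up\<close> for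
      singletons every point of \<open>S\<close> has an edge into \<open>N\<close>, so the
      superlevel set at 1 is all of \<open>S\<close>, and level 1 does not exceed
      \<open>card B\<close>.\<close>
    have pos: "1 \<le> out N v" if "v \<in> S" for v
    proof -
      have "0 < real (card {w\<in>N. \<exists>b\<in>B. w - b \<in> {v}})"
        using up[of "{v}"] that C by simp
      then obtain w b where "w \<in> N" "b \<in> B" "w - b = v"
        by (auto simp: card_gt_0_iff)
      then show ?thesis unfolding out_pos by (auto intro!: bexI[of _ b])
    qed
    with False le(1)[of N] have "1 \<in> {1..card B}"
      by (metis all_not_in_conv atLeastAtMost_iff le_trans order_refl)
    from eq[OF this] have "C * card {u\<in>P. 1 \<le> out S u} = card {v\<in>S. 1 \<le> out N v}" .
    moreover have "{v\<in>S. 1 \<le> out N v} = S" using pos by auto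
    ultimately show ?thesis by (simp only: out_pos)
  qed simp
qed

section \<open>Cuts in the layered addition graph\<close>

text \<open>A family \<open>F\<close> encodes the cut whose part in layer \<open>i\<close> is \<open>entering A B F i - F i\<close>: \<open>F i\<close> is
  the part of layer \<open>i\<close> that is reachable from \<open>A\<close> without meeting the cut.\<close>

definition entering :: "'a::ab_group_add set \<Rightarrow> 'a set \<Rightarrow> (nat \<Rightarrow> 'a set) \<Rightarrow> nat \<Rightarrow> 'a set" where
  "entering A B F i = (case i of 0 \<Rightarrow> A | Suc j \<Rightarrow> F j + B)"

text \<open>With the weight \<open>1 / C ^ i\<close>, a point of layer \<open>i\<close> costs as
  much as \<open>C\<close> points of layer \<open>i + 1\<close>.\<close>

definition cut_weight ::
  "'a::ab_group_add set \<Rightarrow> 'a set \<Rightarrow> real \<Rightarrow> nat \<Rightarrow> (nat \<Rightarrow> 'a set) \<Rightarrow> real" where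
  "cut_weight A B C h F = (\<Sum>i\<le>h. card (entering A B F i - F i) / C ^ i)"

text \<open>Since \<open>F h\<close> is empty, every path from \<open>A\<close> to layer
  \<open>h\<close> meets the cut. A point of \<open>F i\<close> need not be reachable, so one layer
  can be altered without adjusting the others.\<close>

definition cut_family :: "'a::ab_group_add set \<Rightarrow> 'a set \<Rightarrow> nat \<Rightarrow> (nat \<Rightarrow> 'a set) set" where
  "cut_family A B h =
     {F. \<forall>i. (i < h \<longrightarrow> F i \<subseteq> A + iterated_sumset i B) \<and> (h \<le> i \<longrightarrow> F i = {})}"

lemma entering_0 [simp]: "entering A B F 0 = A"
  and entering_Suc [simp]: "entering A B F (Suc i) = F i + B"
  by (simp_all add: entering_def)

lemma finite_cut_family:
  assumes "finite A" "finite B"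
  shows "finite (cut_family A B h)"
proof (rule finite_subset)
  let ?V = "\<Union>i<h. A + iterated_sumset i B"
  have "finite ?V"
    using assms by (auto intro!: finite_set_plus finite_iterated_sumset)
  then show "finite {F. \<forall>i. (i \<in> {..<h} \<longrightarrow> F i \<in> Pow ?V) \<and> (i \<notin> {..<h} \<longrightarrow> F i = {})}"
    by (intro finite_set_of_finite_funs) auto
  show "cut_family A B h \<subseteq>
      {F. \<forall>i. (i \<in> {..<h} \<longrightarrow> F i \<in> Pow ?V) \<and> (i \<notin> {..<h} \<longrightarrow> F i = {})}"
    unfolding cut_family_def by fastforce
qed

lemma cut_family_subset:
  assumes "F \<in> cut_family A B h"
  shows "F i \<subseteq> A + iterated_sumset i B"
  using assms by (cases "i < h") (auto simp: cut_family_def)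

lemma cut_family_step:
  assumes "F \<in> cut_family A B h"
  shows "F i + B \<subseteq> A + iterated_sumset (Suc i) B"
  using set_plus_mono2[OF cut_family_subset[OF assms, of i] order_refl[of B]]
  by (simp add: iterated_sumset_Suc add.assoc)

lemma cut_family_upd:
  assumes "F \<in> cut_family A B h" "m < h" "Y \<subseteq> A + iterated_sumset m B"
  shows "F(m := Y) \<in> cut_family A B h"
  using assms by (auto simp: cut_family_def)

text \<open>The set \<open>F m\<close> enters the weight twice: it is removed in layer
  \<open>m\<close>, and \<open>F m + B\<close> enters layer \<open>m + 1\<close>. All other terms
  cancel.\<close>

lemma cut_weight_upd:
  fixes C :: real
  assumes "m < h"
  shows "cut_weight A B C h (F(m := Y)) - cut_weight A B C h F =
    (real (card (entering A B F m - Y)) - card (entering A B F m - F m)) / C ^ m +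
    (real (card (Y + B - F (Suc m))) - card (F m + B - F (Suc m))) / C ^ Suc m"
    (is "_ = ?a + ?b")
proof -
  have ent: "entering A B (F(m := Y)) i = (if i = Suc m then Y + B else entering A B F i)" for i
    by (cases i) auto
  have "cut_weight A B C h (F(m := Y)) - cut_weight A B C h F =
      (\<Sum>i\<le>h. (if i = m then ?a else 0) + (if i = Suc m then ?b else 0))"
    unfolding cut_weight_def sum_subtractf[symmetric] ent
    by (intro sum.cong) (auto simp: diff_divide_distrib)
  also have "\<dots> = ?a + ?b"
    using assms unfolding sum.distrib by (subst (1 2) sum.delta) auto
  finally show ?thesis .
qed

section \<open>Pushing a cut to a neighbouring layer\<close>

text \<open>All edges from \<open>F m\<close> into the part \<open>T\<close> of the cut start in
  \<open>D\<close>. Putting \<open>D\<close> into the cut therefore frees \<open>T\<close>, at cost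
  at most \<open>card D / C ^ m\<close> and gain at least \<open>card T / C ^ Suc m\<close>.\<close>

lemma cut_weight_push_down:
  fixes C :: real
  assumes fin: "finite A" "finite B" and C: "C > 0"
    and F: "F \<in> cut_family A B h" and m: "m < h"
    and T: "T \<subseteq> F m + B - F (Suc m)"
    and D: "D = {u \<in> F m. \<exists>b\<in>B. u + b \<in> T}"
  shows "cut_weight A B C h (F(m := F m - D)) \<le>
    cut_weight A B C h F + (C * card D - card T) / C ^ Suc m"
proof -
  have finV: "finite (A + iterated_sumset i B)" for i
    using fin by (intro finite_set_plus finite_iterated_sumset)
  have finF: "finite (F i)" for i
    using cut_family_subset[OF F] finV finite_subset by blast
  have finD: "finite D" using finF[of m] D by simp
  have finG: "finite (entering A B F m)"
    using fin finF by (cases m) (auto intro: finite_set_plus)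
  have "card (entering A B F m - (F m - D)) \<le> card ((entering A B F m - F m) \<union> D)"
    using finG finD by (intro card_mono) auto
  also have "\<dots> \<le> card (entering A B F m - F m) + card D" by (rule card_Un_le)
  finally have a: "real (card (entering A B F m - (F m - D))) - card (entering A B F m - F m) \<le> card D"
    by simp
  have finS: "finite (F m + B - F (Suc m))"
    using fin finF by (auto intro: finite_set_plus)
  have "(F m - D) + B - F (Suc m) \<subseteq> (F m + B - F (Suc m)) - T"
    using D by (auto simp: set_plus_def)
  then have "card ((F m - D) + B - F (Suc m)) \<le> card ((F m + B - F (Suc m)) - T)"
    using finS by (intro card_mono) auto
  also have "\<dots> = card (F m + B - F (Suc m)) - card T"
    using T finS by (intro card_Diff_subset) (auto intro: finite_subset)
  finally have b: "real (card ((F m - D) + B - F (Suc m))) - card (F m + B - F (Suc m)) \<le> - real (card T)"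
    using card_mono[OF finS T] by linarith
  have "(real (card (entering A B F m - (F m - D))) - card (entering A B F m - F m)) / C ^ m \<le> card D / C ^ m"
    using a C by (intro divide_right_mono) auto
  moreover have "(real (card ((F m - D) + B - F (Suc m))) - card (F m + B - F (Suc m))) / C ^ Suc m
      \<le> - real (card T) / C ^ Suc m"
    using b C by (intro divide_right_mono) auto
  moreover have "card D / C ^ m + - real (card T) / C ^ Suc m = (C * card D - card T) / C ^ Suc m"
    using C by (simp add: field_simps)
  ultimately show ?thesis
    using cut_weight_upd[OF m, of A B C F "F m - D"] by linarith
qed

text \<open>Opening the part \<open>T\<close> of the cut saves its weight in layer
  \<open>m + 1\<close>. The cut grows in layer \<open>m + 2\<close> by the newly entered points
  outside \<open>F (m + 2)\<close>, all of which lie in \<open>E\<close>.\<close>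

lemma cut_weight_push_up:
  fixes C :: real
  assumes fin: "finite A" "finite B" and C: "C > 0"
    and F: "F \<in> cut_family A B h" and m: "Suc m < h"
    and T: "T \<subseteq> F m + B - F (Suc m)"
    and N: "(T + B) - (F (Suc m) + B) - F (Suc (Suc m)) \<subseteq> E" "finite E"
  shows "cut_weight A B C h (F(Suc m := F (Suc m) \<union> T)) \<le>
    cut_weight A B C h F + (card E - C * card T) / C ^ Suc (Suc m)"
proof -
  have finV: "finite (A + iterated_sumset i B)" for i
    using fin by (intro finite_set_plus finite_iterated_sumset)
  have finF: "finite (F i)" for i
    using cut_family_subset[OF F] finV finite_subset by blast
  have finS: "finite (F i + B - F j)" for i j
    using fin finF by (auto intro: finite_set_plus)
  have "F m + B - (F (Suc m) \<union> T) = (F m + B - F (Suc m)) - T" by auto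
  then have "card (F m + B - (F (Suc m) \<union> T)) = card (F m + B - F (Suc m)) - card T"
    using T finS by (metis card_Diff_subset finite_subset)
  then have a: "real (card (F m + B - (F (Suc m) \<union> T))) - card (F m + B - F (Suc m)) = - real (card T)"
    using card_mono[OF finS T] by linarith
  have "(F (Suc m) \<union> T) + B - F (Suc (Suc m)) \<subseteq> (F (Suc m) + B - F (Suc (Suc m))) \<union> E"
    using N(1) by (auto simp: set_plus_def)
  then have "card ((F (Suc m) \<union> T) + B - F (Suc (Suc m))) \<le>
      card ((F (Suc m) + B - F (Suc (Suc m))) \<union> E)"
    using finS N by (intro card_mono) auto
  also have "\<dots> \<le> card (F (Suc m) + B - F (Suc (Suc m))) + card E" by (rule card_Un_le)
  finally have b: "real (card ((F (Suc m) \<union> T) + B - F (Suc (Suc m))))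
      - card (F (Suc m) + B - F (Suc (Suc m))) \<le> card E"
    by simp
  have "(real (card ((F (Suc m) \<union> T) + B - F (Suc (Suc m))))
      - card (F (Suc m) + B - F (Suc (Suc m)))) / C ^ Suc (Suc m) \<le> card E / C ^ Suc (Suc m)"
    using b C by (intro divide_right_mono) auto
  moreover have "- real (card T) / C ^ Suc m + card E / C ^ Suc (Suc m) =
      (card E - C * card T) / C ^ Suc (Suc m)"
    using C by (simp add: field_simps)
  ultimately show ?thesis
    using cut_weight_upd[OF m, of A B C F "F (Suc m) \<union> T"] a by simp
qed

text \<open>Neither push can lower the minimum weight, which gives the two expansion hypotheses of
  \<open>balanced_layer_card\<close> for the cut \<open>S\<close> in layer \<open>m + 1\<close>. The
  resulting equality says that pushing all of \<open>S\<close> down to layer \<open>m\<close> is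
  free.\<close>

lemma minimal_cut_clear_layer:
  fixes C :: real
  assumes fin: "finite A" "finite B" and C: "C > 0"
    and F: "F \<in> cut_family A B h" and m: "Suc m < h"
    and min: "\<And>F'. F' \<in> cut_family A B h \<Longrightarrow> cut_weight A B C h F \<le> cut_weight A B C h F'"
  obtains Y where "F(m := Y) \<in> cut_family A B h" "Y + B \<subseteq> F (Suc m)"
    "cut_weight A B C h (F(m := Y)) = cut_weight A B C h F"
proof -
  have finV: "finite (A + iterated_sumset i B)" for i
    using fin by (intro finite_set_plus finite_iterated_sumset)
  have finF: "finite (F i)" for i
    using cut_family_subset[OF F] finV finite_subset by blast
  define S where "S = F m + B - F (Suc m)"
  \<comment> \<open>The points of layer \<open>m + 2\<close> that are neither entered from
    \<open>F (m + 1)\<close> nor in \<open>F (m + 2)\<close>. Leaving out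
    \<open>F (m + 1) + B\<close> is what makes the square condition hold.\<close>
  define N where "N = (A + iterated_sumset (Suc (Suc m)) B) - (F (Suc m) + B) - F (Suc (Suc m))"
  define D where "D T = {u \<in> F m. \<exists>b\<in>B. u + b \<in> T}" for T
  have fam: "F(m := F m - D T) \<in> cut_family A B h" for T
    using m cut_family_subset[OF F, of m] by (intro cut_family_upd[OF F]) auto
  have push: "cut_weight A B C h (F(m := F m - D T)) \<le>
      cut_weight A B C h F + (C * card (D T) - card T) / C ^ Suc m" if "T \<subseteq> S" for T
    using cut_weight_push_down[OF fin C F, of m T] m that unfolding S_def D_def by simp
  have nonneg: "0 \<le> x" if "0 \<le> x / C ^ n" for x n
    using that zero_less_power[OF C, of n] by (auto simp: zero_le_divide_iff)
  have eq: "C * card (D S) = card S"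
    unfolding D_def
  proof (rule balanced_layer_card[where N = N])
    show "finite S" "finite N"
      unfolding S_def N_def using fin finF finV by (auto intro: finite_set_plus)
    show "u + c \<in> S" if "u \<in> F m" "b \<in> B" "c \<in> B" "u + b \<in> S" "u + b + c \<in> N" for u b c
    proof -
      have "u + c \<notin> F (Suc m)"
      proof
        assume "u + c \<in> F (Suc m)"
        then have "u + c + b \<in> F (Suc m) + B" using that by (intro set_plus_intro)
        then show False using that(5) by (simp add: N_def add_ac)
      qed
      then show ?thesis using that by (simp add: S_def set_plus_intro)
    qed
    show "card T \<le> C * card {u \<in> F m. \<exists>b\<in>B. u + b \<in> T}" if "T \<subseteq> S" for T
    proof -
      have "0 \<le> (C * card (D T) - card T) / C ^ Suc m"
        using push[OF that] min[OF fam[of T]] by linarith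
      from nonneg[OF this] show ?thesis by (simp add: D_def)
    qed
    show "C * card T \<le> card {w \<in> N. \<exists>b\<in>B. w - b \<in> T}" if "T \<subseteq> S" for T
    proof -
      let ?E = "{w \<in> N. \<exists>b\<in>B. w - b \<in> T}"
      have TV: "T \<subseteq> A + iterated_sumset (Suc m) B"
        using that cut_family_step[OF F, of m] by (auto simp: S_def)
      then have "T + B \<subseteq> A + iterated_sumset (Suc (Suc m)) B"
        using set_plus_mono2[OF TV order_refl[of B]]
        by (simp add: iterated_sumset_Suc[of "Suc m"] add.assoc)
      then have sub: "(T + B) - (F (Suc m) + B) - F (Suc (Suc m)) \<subseteq> ?E"
        by (force simp: N_def elim!: set_plus_elim)
      have "F(Suc m := F (Suc m) \<union> T) \<in> cut_family A B h"
        using m TV cut_family_subset[OF F, of "Suc m"] by (intro cut_family_upd[OF F]) auto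
      note min[OF this]
      moreover have "finite ?E" using finV by (simp add: N_def)
      ultimately have "0 \<le> (card ?E - C * card T) / C ^ Suc (Suc m)"
        using cut_weight_push_up[OF fin C F m _ sub] that unfolding S_def by fastforce
      from nonneg[OF this] show ?thesis by simp
    qed
  qed (use finF fin C in auto)
  show thesis
  proof
    show "F(m := F m - D S) \<in> cut_family A B h" by (rule fam)
    show "F m - D S + B \<subseteq> F (Suc m)"
      by (auto simp: D_def S_def elim!: set_plus_elim intro: set_plus_intro)
    show "cut_weight A B C h (F(m := F m - D S)) = cut_weight A B C h F"
      using push[of S] min[OF fam[of S]] eq by simp
  qed
qed

text \<open>The layers are cleared from \<open>h - 1\<close> down to 1. Clearing layer
  \<open>m + 1\<close> changes only \<open>F m\<close>, so the layers above stay clear; layer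
  \<open>m\<close> may gain cut points but is treated next.\<close>

lemma minimal_cut_in_end_layers:
  fixes C :: real
  assumes fin: "finite A" "finite B" and C: "C > 0"
  obtains F where "F \<in> cut_family A B h"
    "\<forall>F' \<in> cut_family A B h. cut_weight A B C h F \<le> cut_weight A B C h F'"
    "\<forall>i. Suc i < h \<longrightarrow> F i + B \<subseteq> F (Suc i)"
proof -
  let ?W = "cut_weight A B C h" and ?K = "cut_family A B h"
  have "\<exists>F\<in>?K. (\<forall>F'\<in>?K. ?W F \<le> ?W F') \<and> (\<forall>i. h - n \<le> Suc i \<and> Suc i < h \<longrightarrow> F i + B \<subseteq> F (Suc i))"
    for n
  proof (induction n)
    case 0
    \<comment> \<open>This family, whose cut is \<open>A\<close> itself, shows that there is
      something to minimise over.\<close>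
    have "(\<lambda>_. {}) \<in> ?K" by (simp add: cut_family_def)
    then obtain F where "F \<in> ?K" "\<forall>F'\<in>?K. ?W F \<le> ?W F'"
      using ex_is_arg_min_if_finite[OF finite_cut_family[OF fin, of h], of ?W]
      by (auto simp: is_arg_min_linorder)
    then show ?case by auto
  next
    case (Suc n)
    then obtain F where F: "F \<in> ?K" "\<forall>F'\<in>?K. ?W F \<le> ?W F'"
      "\<forall>i. h - n \<le> Suc i \<and> Suc i < h \<longrightarrow> F i + B \<subseteq> F (Suc i)" by blast
    show ?case
    proof (cases "\<exists>m. h - Suc n = Suc m \<and> Suc m < h")
      case True
      then obtain m where m: "h - Suc n = Suc m" "Suc m < h" by blast
      obtain Y where Y: "F(m := Y) \<in> ?K" "Y + B \<subseteq> F (Suc m)" "?W (F(m := Y)) = ?W F"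
        by (rule minimal_cut_clear_layer[OF fin C F(1) m(2)]) (use F(2) in blast)+
      have "(F(m := Y)) i + B \<subseteq> (F(m := Y)) (Suc i)" if "h - Suc n \<le> Suc i" "Suc i < h" for i
        using that m Y(2) F(3) by (cases "i = m") auto
      then show ?thesis using Y F(2) by (intro bexI[of _ "F(m := Y)"]) (auto simp del: fun_upd_apply)
    next
      \<comment> \<open>Here the truncated difference \<open>h - Suc n\<close> is 0, so no further
        inner layer remains to be cleared.\<close>
      case False
      have "h - n \<le> Suc i" if "h - Suc n \<le> Suc i" "Suc i < h" for i
      proof (rule ccontr)
        assume "\<not> h - n \<le> Suc i"
        with that have "h - Suc n = Suc i" by simp
        with that False show False by blast
      qed
      then show ?thesis using F by (intro bexI[of _ F]) auto
    qed
  qed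
  from this[of h] show thesis using that by auto
qed

section \<open>Pluennecke's inequality\<close>

theorem pluennecke:
  fixes A B :: "'a::ab_group_add set" and C :: real
  assumes fin: "finite A" "finite B" and C: "C > 0" and "j \<le> h"
    and expand: "\<And>X. X \<subseteq> A \<Longrightarrow> C ^ h * card X \<le> card (X + iterated_sumset h B)"
  shows "C ^ j * card A \<le> card (A + iterated_sumset j B)"
proof -
  obtain F where F: "F \<in> cut_family A B h"
    "\<And>F'. F' \<in> cut_family A B h \<Longrightarrow> cut_weight A B C h F \<le> cut_weight A B C h F'"
    "\<And>i. Suc i < h \<Longrightarrow> F i + B \<subseteq> F (Suc i)"
    using minimal_cut_in_end_layers[OF fin C, of h] by metis
  have "real (card A) \<le> cut_weight A B C h F"
  proof (cases h)
    case 0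
    with F(1) show ?thesis by (simp add: cut_weight_def cut_family_def)
  next
    case (Suc n)
    have F0: "F 0 \<subseteq> A" using cut_family_subset[OF F(1), of 0] by simp
    have Fh: "F h = {}" using F(1) by (simp add: cut_family_def)
    have fin0: "finite (F 0)" using F0 fin finite_subset by blast
    \<comment> \<open>With no cut in the inner layers, all that is reached from \<open>F 0\<close>
      stays open up to layer \<open>h - 1\<close>. Hence all of
      \<open>F 0 + iterated_sumset h B\<close> lies in the cut at layer \<open>h\<close>, and
      \<open>expand\<close> for \<open>F 0\<close> bounds its weight below by
      \<open>card (F 0)\<close>.\<close>
    have "i < h \<Longrightarrow> F 0 + iterated_sumset i B \<subseteq> F i" for i
    proof (induction i)
      case (Suc i)
      then have "F 0 + iterated_sumset i B + B \<subseteq> F i + B" by (intro set_plus_mono2) auto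
      then show ?case using F(3)[of i] Suc by (simp add: iterated_sumset_Suc add.assoc)
    qed simp
    then have "F 0 + iterated_sumset n B + B \<subseteq> F n + B"
      using Suc by (intro set_plus_mono2) auto
    then have sub: "F 0 + iterated_sumset h B \<subseteq> entering A B F h - F h"
      using Suc Fh by (simp add: iterated_sumset_Suc add.assoc)
    have "finite (F n)"
      using cut_family_subset[OF F(1), of n] fin
      by (meson finite_iterated_sumset finite_set_plus finite_subset)
    then have "finite (entering A B F h - F h)"
      using fin Suc by (auto intro: finite_set_plus)
    then have "real (card (F 0 + iterated_sumset h B)) \<le> card (entering A B F h - F h)"
      using sub by (simp add: card_mono)
    with expand[OF F0] have "card (F 0) \<le> card (entering A B F h - F h) / C ^ h"
      using C by (simp add: field_simps)
    moreover have "card (A - F 0) = card A - card (F 0)" "card (F 0) \<le> card A"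
      using F0 fin fin0 by (auto intro: card_Diff_subset card_mono)
    moreover have "card (entering A B F 0 - F 0) / C ^ 0 + card (entering A B F h - F h) / C ^ h
        \<le> cut_weight A B C h F"
    proof -
      have "(\<Sum>i\<in>{0, h}. card (entering A B F i - F i) / C ^ i) \<le> cut_weight A B C h F"
        unfolding cut_weight_def using C by (intro sum_mono2) auto
      then show ?thesis using Suc by simp
    qed
    ultimately show ?thesis by simp
  qed
  \<comment> \<open>The competitor leaves everything below layer \<open>j\<close> open and nothing
    from \<open>j\<close> on, so its cut is exactly layer \<open>j\<close>.\<close>
  also have "\<dots> \<le> cut_weight A B C h (\<lambda>i. if i < j then A + iterated_sumset i B else {})"
    using \<open>j \<le> h\<close> by (intro F(2)) (auto simp: cut_family_def)
  also have "\<dots> = (\<Sum>i\<le>h. if i = j then card (A + iterated_sumset j B) / C ^ j else 0)"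
    unfolding cut_weight_def
  proof (intro sum.cong refl)
    fix i
    show "card (entering A B (\<lambda>i. if i < j then A + iterated_sumset i B else {}) i
        - (if i < j then A + iterated_sumset i B else {})) / C ^ i =
        (if i = j then card (A + iterated_sumset j B) / C ^ j else 0)"
      by (cases i) (auto simp: iterated_sumset_Suc add.assoc set_plus_def[of "{}"])
  qed
  also have "\<dots> = card (A + iterated_sumset j B) / C ^ j"
    using \<open>j \<le> h\<close> by simp
  finally show ?thesis using C by (simp add: field_simps)
qed

section \<open>Counting lattice points in boxes\<close>

lemma card_vec_box:
  assumes "finite S"
  shows "finite {x :: 'a ^ 'n. \<forall>i. x $ i \<in> S}"
    and "card {x :: 'a ^ 'n. \<forall>i. x $ i \<in> S} = card S ^ CARD('n::finite)"
proof -
  have bij: "bij_betw vec_nth {x :: 'a ^ 'n. \<forall>i. x $ i \<in> S} (UNIV \<rightarrow>\<^sub>E S)"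
    by (rule bij_betw_byWitness[where f' = vec_lambda]) (auto simp: PiE_def)
  have "finite ((UNIV :: 'n set) \<rightarrow>\<^sub>E S)" using assms by (intro finite_PiE) auto
  then show "finite {x :: 'a ^ 'n. \<forall>i. x $ i \<in> S}" using bij bij_betw_finite by blast
  show "card {x :: 'a ^ 'n. \<forall>i. x $ i \<in> S} = card S ^ CARD('n)"
    using bij_betw_same_card[OF bij] by (simp add: card_PiE)
qed

lemma finite_discrete_cube: "finite (discrete_cube k :: (int ^ 'n::finite) set)"
  and card_discrete_cube: "card (discrete_cube k :: (int ^ 'n) set) = k ^ CARD('n)"
  unfolding discrete_cube_def using card_vec_box[of "{0..int k - 1}"] by simp_all

text \<open>Each coordinate of a sum of \<open>k\<close> cube points lies between 0 and
  \<open>k * (k - 1)\<close>.\<close>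

lemma card_iterated_sumset_cube_le:
  assumes "k > 0"
  shows "card (iterated_sumset k (discrete_cube k :: (int ^ 'n::finite) set)) \<le> (k * (k - 1) + 1) ^ CARD('n)"
proof -
  have "iterated_sumset j (discrete_cube k :: (int ^ 'n) set) \<subseteq> {x. \<forall>i. x $ i \<in> {0..int j * (int k - 1)}}" for j
  proof (induction j)
    case (Suc j)
    have "a $ i + b $ i \<in> {0..int (Suc j) * (int k - 1)}"
      if "a \<in> iterated_sumset j (discrete_cube k)" "b \<in> discrete_cube k" for a b :: "int ^ 'n" and i
    proof -
      have "0 \<le> a $ i" "a $ i \<le> int j * (int k - 1)" using Suc that(1) by auto
      moreover have "0 \<le> b $ i" "b $ i \<le> int k - 1" using that(2) by (auto simp: discrete_cube_def)
      ultimately show ?thesis by (simp add: algebra_simps)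
    qed
    then show ?case by (auto simp: iterated_sumset_Suc elim!: set_plus_elim)
  qed (auto simp: zero_index)
  then have "card (iterated_sumset k (discrete_cube k :: (int ^ 'n) set)) \<le>
      card {x :: int ^ 'n. \<forall>i. x $ i \<in> {0..int k * (int k - 1)}}"
    by (intro card_mono card_vec_box) auto
  also have "\<dots> = nat (int k * (int k - 1) + 1) ^ CARD('n)"
    by (subst card_vec_box) auto
  also have "int k * (int k - 1) + 1 = int (k * (k - 1) + 1)"
    using assms by (simp add: of_nat_diff)
  finally show ?thesis by (metis nat_int)
qed

text \<open>The cubes translated by \<open>k x\<close>, for \<open>x\<close> in \<open>X\<close>,
  are disjoint by uniqueness of division with remainder in each coordinate. They lie in the sumset
  because \<open>k x\<close> is a sum of \<open>k\<close> copies of \<open>x\<close>.\<close>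

lemma card_dilate_plus_cube:
  fixes X :: "(int ^ 'n::finite) set"
  assumes "finite X" "k > 0"
  shows "k ^ CARD('n) * card X \<le> card (iterated_sumset k X + discrete_cube k)"
proof -
  define f :: "(int ^ 'n) \<times> (int ^ 'n) \<Rightarrow> int ^ 'n" where "f = (\<lambda>(x, q). (\<chi> i. int k * x $ i) + q)"
  have mem: "(\<chi> i. int j * x $ i) \<in> iterated_sumset j X" if "x \<in> X" for x j
  proof (induction j)
    case (Suc j)
    have "(\<chi> i. int (Suc j) * x $ i) = (\<chi> i. int j * x $ i) + x"
      by (simp add: vec_eq_iff algebra_simps)
    then show ?case using Suc that by (simp add: iterated_sumset_Suc set_plus_intro)
  qed (simp add: vec_eq_iff)
  have "inj_on f (X \<times> discrete_cube k)"
  proof (rule inj_onI, clarify)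
    fix x q y r assume q: "q \<in> discrete_cube k" "r \<in> discrete_cube k" and eq: "f (x, q) = f (y, r)"
    have eqi: "int k * x $ i + q $ i = int k * y $ i + r $ i" for i
      using arg_cong[OF eq, of "\<lambda>v. v $ i"] by (simp add: f_def)
    have bnd: "0 \<le> q $ i" "q $ i < int k" "0 \<le> r $ i" "r $ i < int k" for i
      using q by (auto simp: discrete_cube_def)
    \<comment> \<open>The offsets lie in \<open>{0..<k}\<close>, so division by \<open>k\<close>
      recovers the coordinate of the corner.\<close>
    have "x $ i = y $ i" for i
      using arg_cong[OF eqi[of i], of "\<lambda>z. z div int k"] bnd[of i] by simp
    then show "x = y \<and> q = r" using eqi by (simp add: vec_eq_iff)
  qed
  then have "card (f ` (X \<times> discrete_cube k)) = card X * k ^ CARD('n)"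
    by (simp add: card_image card_cartesian_product card_discrete_cube)
  moreover have "f ` (X \<times> discrete_cube k) \<subseteq> iterated_sumset k X + discrete_cube k"
    using mem by (auto simp: f_def intro: set_plus_intro)
  then have "card (f ` (X \<times> discrete_cube k)) \<le> card (iterated_sumset k X + discrete_cube k)"
    using assms finite_discrete_cube
    by (intro card_mono finite_set_plus finite_iterated_sumset) auto
  ultimately show ?thesis by (simp add: mult.commute)
qed

section \<open>The lower bound and the infimum\<close>

lemma card_iterated_sumset_ge:
  fixes A :: "(int ^ 'n::finite) set"
  assumes k: "k > 0" and A: "discrete_cube k \<subseteq> A" "finite A"
  shows "real k powr (real CARD('n) * (real k - 1) / real k) * card A \<le> card (iterated_sumset k A)"
proof -
  \<comment> \<open>Chosen so that \<open>C ^ k\<close> is the expansion \<open>k ^ d\<close>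
    available in layer \<open>k\<close>; then \<open>C ^ (k - 1)\<close> is the claimed factor for
    layer \<open>k - 1\<close>, which is the \<open>k\<close>-fold sumset of
    \<open>A\<close>.\<close>
  define C where "C = real k powr (CARD('n) / k)"
  have C: "C > 0" using k by (simp add: C_def)
  obtain n where n: "k = Suc n" using k by (cases k) auto
  have Ck: "C ^ k = real k ^ CARD('n)"
    using k by (simp add: C_def powr_realpow[symmetric] powr_powr)
  have Cn: "C ^ n = real k powr (real CARD('n) * (real k - 1) / real k)"
    using k C by (simp add: powr_realpow[symmetric], simp add: C_def powr_powr n)
  have "C ^ n * card A \<le> card (A + iterated_sumset n A)"
  proof (rule pluennecke[where h = k])
    fix X assume X: "X \<subseteq> A"
    have finX: "finite X" using X A finite_subset by blast
    \<comment> \<open>One summand \<open>X\<close> is kept; the other \<open>k - 1\<close> copies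
      and the cube are each enlarged to \<open>A\<close>.\<close>
    have "iterated_sumset k X + discrete_cube k \<subseteq> (X + iterated_sumset n A) + A"
      using iterated_sumset_mono[OF X, of n] A X unfolding n iterated_sumset_Suc add.commute[of _ X]
      by (intro set_plus_mono2) (auto simp: n)
    then have "card (iterated_sumset k X + discrete_cube k) \<le> card (X + iterated_sumset k A)"
      using finX A unfolding n iterated_sumset_Suc add.assoc
      by (intro card_mono finite_set_plus finite_iterated_sumset) auto
    with card_dilate_plus_cube[OF finX k] show "C ^ k * card X \<le> card (X + iterated_sumset k A)"
      unfolding Ck by (metis of_nat_le_iff of_nat_mult of_nat_power order_trans)
  qed (use A C n in auto)
  then show ?thesis by (simp add: Cn n iterated_sumset_Suc add.commute)
qed

theorem theorem1p5:
  fixes k :: nat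
  assumes "k > 0"
  shows "(real k - 1 + 1 / real k) ^ CARD('n::finite) \<ge>
           (INF A \<in> {A :: (int ^ 'n) set. discrete_cube k \<subseteq> A \<and> finite A}.
              real (card (iterated_sumset k A)) / real (card A))
       \<and> (INF A \<in> {A :: (int ^ 'n) set. discrete_cube k \<subseteq> A \<and> finite A}.
              real (card (iterated_sumset k A)) / real (card A)) \<ge>
           real k powr (real CARD('n) * (real k - 1) / real k)"
proof
  let ?Q = "discrete_cube k :: (int ^ 'n) set"
  let ?f = "\<lambda>A :: (int ^ 'n) set. real (card (iterated_sumset k A)) / real (card A)"
  let ?K = "{A :: (int ^ 'n) set. ?Q \<subseteq> A \<and> finite A}"
  have mem: "?Q \<in> ?K" by (simp add: finite_discrete_cube)
  \<comment> \<open>A real infimum is a lower bound only for a set that is bounded below.\<close>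
  have bdd: "bdd_below (?f ` ?K)" by (rule bdd_belowI2[of _ 0]) simp
  have "(INF A\<in>?K. ?f A) \<le> ?f ?Q" by (rule cINF_lower[OF bdd mem])
  also have "\<dots> \<le> real ((k * (k - 1) + 1) ^ CARD('n)) / real (k ^ CARD('n))"
    using card_iterated_sumset_cube_le[OF assms, where 'n = 'n]
    unfolding card_discrete_cube by (intro divide_right_mono) (simp_all only: of_nat_le_iff of_nat_0_le_iff)
  also have "\<dots> = (real (k * (k - 1) + 1) / real k) ^ CARD('n)"
    by (simp add: power_divide)
  also have "real (k * (k - 1) + 1) / real k = real k - 1 + 1 / real k"
    using assms by (simp add: of_nat_diff field_simps)
  finally show "(INF A\<in>?K. ?f A) \<le> (real k - 1 + 1 / real k) ^ CARD('n)" .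
  show "real k powr (real CARD('n) * (real k - 1) / real k) \<le> (INF A\<in>?K. ?f A)"
  proof (rule cINF_greatest)
    fix A assume "A \<in> ?K"
    then have A: "?Q \<subseteq> A" "finite A" by auto
    then have "card ?Q \<le> card A" by (intro card_mono)
    then have "card A > 0" using assms by (simp add: card_discrete_cube) (metis gr0I le_0_eq power_not_zero)
    then show "real k powr (real CARD('n) * (real k - 1) / real k) \<le> ?f A"
      using card_iterated_sumset_ge[OF assms A] by (simp add: pos_le_divide_eq)
  qed (use mem in blast)
qed

end
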